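(* Let $N,n\ge 1$ be integers, let $A_i\in\mathbf{R}^{n\times n}$ and $\tau_i>0$, $i\in\mathbf{I}[1,N]$. The following statements are equivalent. A. There exist $N+1$ positive definite matrices $P,Q_i\in\mathbf{R}^{n\times n}$, $i\in\mathbf{I}[1,N]$, such that $$N\tau_iA_i^{\mathrm{T}}\Big(P+\sum_{j=1}^{N}\tau_jQ_j\Big)A_i-Q_i<0,\quad i\in\mathbf{I}[1,N].$$ B. There exist $N$ positive definite matrices $Q_i\in\mathbf{R}^{n\times n}$, $i\in\mathbf{I}[1,N]$, such that $$N\tau_i^{2}A_i^{\mathrm{T}}\Big(\sum_{j=1}^{N}Q_j\Big)A_i-Q_i<0,\quad i\in\mathbf{I}[1,N].$$ C. $$\rho\Big(\sum_{i=1}^{N}\tau_i^{2}A_i\otimes A_i\Big)<\frac1N .$$ D. There exists a positive definite matrix $Q\in\mathbf{R}^{n\times n}$ such that $$\sum_{i=1}^{N}N\tau_i^{2}A_i^{\mathrm{T}}QA_i-Q<0.$$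
   Context: Notation: $\mathbf{I}[1,N]=\{1,2,\ldots,N\}$. Positive definite matrices are real symmetric; for a symmetric matrix, $X<0$ means that $-X$ is positive definite. $\rho(A)$ denotes the spectral radius of a square matrix $A$, and $\otimes$ denotes the Kronecker product. *)

theory Defs
  imports "Jordan_Normal_Form.Spectral_Radius"
begin

definition pos_def_mat :: "nat \<Rightarrow> real mat \<Rightarrow> bool" where
  "pos_def_mat n X \<longleftrightarrow> X \<in> carrier_mat n n \<and> transpose_mat X = X \<and>
     (\<forall>v \<in> carrier_vec n. v \<noteq> 0\<^sub>v n \<longrightarrow> 0 < v \<bullet> (X *\<^sub>v v))"

definition neg_def_mat :: "nat \<Rightarrow> real mat \<Rightarrow> bool" where
  "neg_def_mat n X \<longleftrightarrow> pos_def_mat n (- X)"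

text \<open>Matrices of unspecified dimension do not form a \<^class>\<open>comm_monoid_add\<close>, so
  \<^const>\<open>sum\<close> is not applicable to them. The first argument below is the common dimension of the
  (square) summands.\<close>

definition mat_sum :: "nat \<Rightarrow> ('i \<Rightarrow> real mat) \<Rightarrow> 'i set \<Rightarrow> real mat" where
  "mat_sum n F I = mat n n (\<lambda>(r, c). \<Sum>i\<in>I. F i $$ (r, c))"

lemma mat_sum_empty: "mat_sum n F {} = 0\<^sub>m n n"
  by (rule eq_matI) (auto simp: mat_sum_def)

lemma mat_sum_insert:
  assumes "finite I" "i \<notin> I" "F i \<in> carrier_mat n n"
  shows "mat_sum n F (insert i I) = F i + mat_sum n F I"
  using assms by (intro eq_matI) (auto simp: mat_sum_def)

definition kronecker :: "real mat \<Rightarrow> real mat \<Rightarrow> real mat" (infixl "\<otimes>\<^sub>K" 72) where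
  "A \<otimes>\<^sub>K B = mat (dim_row A * dim_row B) (dim_col A * dim_col B)
     (\<lambda>(r, c). A $$ (r div dim_row B, c div dim_col B) * B $$ (r mod dim_row B, c mod dim_col B))"

end

theory Submission
  imports Defs
begin

text \<open>
  Everything is compared with the single matrix inequality \<open>L Q < Q\<close>, where
  \<open>L X = (\<Sum>i. w\<^sub>i A\<^sub>i\<^sup>T X A\<^sub>i)\<close> and \<open>w\<^sub>i = N \<tau>\<^sub>i\<^sup>2\<close>; its solvability in positive definite
  matrices \<open>Q\<close> is statement D.

  The spectral radius enters because vectorisation turns \<open>L\<close> into multiplication by the transpose of
  \<open>M = (\<Sum>i. w\<^sub>i A\<^sub>i \<otimes> A\<^sub>i)\<close>, so that the entries of \<open>M\<^sup>k\<close> are entries of iterates of \<open>L\<close>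
  (\<open>flatten_Lyap_funpow\<close>). A complex matrix has spectral radius below one exactly when its powers tend
  to zero (\<open>spectral_radius_less_1_iff_powers_tendsto_0\<close>), and \<open>M\<close> is \<open>N\<close> times the matrix in C.
  Hence C says that the iterates of \<open>L\<close> vanish in the limit, and this has to be matched with D:

  \<^item> Given \<open>L Q < Q\<close>, compactness of the unit sphere would give \<open>L Q \<le> \<alpha> Q\<close> with \<open>\<alpha> < 1\<close>; here the
    uniform constant comes from the inverse of the positive definite matrix \<open>Q - L Q\<close> and the
    Cauchy-Schwarz inequality (\<open>pos_def_coercive\<close>). Since \<open>L\<close> acts on a bilinear form by substituting
    \<open>A\<^sub>i u\<close> and \<open>A\<^sub>i v\<close>, a bound \<open>\<bar>u\<^sup>T X v\<bar> \<le> C (u\<^sup>T Q u + v\<^sup>T Q v)\<close> improves by the factor \<open>\<alpha>\<close> with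
    every application of \<open>L\<close>. Such a bound holds for every real \<open>X\<close>, symmetric or not, so all of
    \<open>M\<^sup>k\<close> decays.

  \<^item> Conversely, if the iterates vanish, some \<open>L\<^sup>m I\<close> is smaller than \<open>I\<close>, and the truncated Neumann
    series \<open>Q = I + L I + \<dots> + L\<^bsup>m-1\<^esup> I\<close> satisfies \<open>Q - L Q = I - L\<^sup>m I > 0\<close>.

  The coupled systems A and B differ from D only by bookkeeping. With \<open>R\<^sub>i = \<tau>\<^sub>i Q\<^sub>i\<close>, statement A
  becomes B with an additional positive definite term \<open>P\<close>, whose omission only weakens the
  inequalities. Adding up the inequalities of B gives D for the sum of the \<open>Q\<^sub>i\<close>. From a solution of D
  the slack \<open>Q - L Q \<ge> e I\<close> is distributed evenly: with \<open>d = e / (N + 1)\<close>, the matrices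
  \<open>R\<^sub>i = w\<^sub>i A\<^sub>i\<^sup>T Q A\<^sub>i + d I\<close> and \<open>P = d I\<close> add up to \<open>L Q + e I \<le> Q\<close>, and the term \<open>d I\<close> in \<open>R\<^sub>i\<close>
  makes each inequality strict. So A implies B, B implies D, and D implies A.
\<close>

section \<open>Bilinear forms and definiteness\<close>

definition bilin :: "real mat \<Rightarrow> real vec \<Rightarrow> real vec \<Rightarrow> real" where
  "bilin X u v = u \<bullet> (X *\<^sub>v v)"

lemma bilin_eq_sum:
  assumes "X \<in> carrier_mat n n" "u \<in> carrier_vec n" "v \<in> carrier_vec n"
  shows "bilin X u v = (\<Sum>a<n. \<Sum>b<n. X $$ (a, b) * (u $ a * v $ b))"
proof -
  have "bilin X u v = (\<Sum>a<n. u $ a * (\<Sum>b<n. X $$ (a, b) * v $ b))"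
    using assms by (simp add: bilin_def scalar_prod_def lessThan_atLeast0)
  then show ?thesis by (simp add: sum_distrib_left mult_ac)
qed

lemma bilin_unit_vec:
  assumes "X \<in> carrier_mat n n" "a < n" "b < n"
  shows "bilin X (unit_vec n a) (unit_vec n b) = X $$ (a, b)"
  using assms by (simp add: bilin_def)

lemma bilin_commute:
  assumes "X \<in> carrier_mat n n" "transpose_mat X = X" "u \<in> carrier_vec n" "v \<in> carrier_vec n"
  shows "bilin X u v = bilin X v u"
  using transpose_vec_mult_scalar[of X n n u v] assms
  by (metis bilin_def comm_scalar_prod mult_mat_vec_carrier)

lemma bilin_add:
  assumes "X \<in> carrier_mat n n" "Y \<in> carrier_mat n n" "u \<in> carrier_vec n" "v \<in> carrier_vec n"
  shows "bilin (X + Y) u v = bilin X u v + bilin Y u v"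
  using assms by (simp add: bilin_eq_sum[of _ n] sum.distrib algebra_simps)

lemma bilin_diff:
  assumes "X \<in> carrier_mat n n" "Y \<in> carrier_mat n n" "u \<in> carrier_vec n" "v \<in> carrier_vec n"
  shows "bilin (X - Y) u v = bilin X u v - bilin Y u v"
  using assms by (simp add: bilin_eq_sum[of _ n] minus_carrier_mat sum_subtractf left_diff_distrib)

lemma bilin_smult:
  assumes "X \<in> carrier_mat n n" "u \<in> carrier_vec n" "v \<in> carrier_vec n"
  shows "bilin (c \<cdot>\<^sub>m X) u v = c * bilin X u v"
  using assms by (simp add: bilin_eq_sum[of _ n] sum_distrib_left mult_ac)

lemma bilin_one:
  assumes "u \<in> carrier_vec n" "v \<in> carrier_vec n"
  shows "bilin (1\<^sub>m n) u v = u \<bullet> v"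
  using assms by (simp add: bilin_def)

lemma mat_sum_carrier [simp]: "mat_sum n F I \<in> carrier_mat n n"
  by (simp add: mat_sum_def)

lemma mat_sum_index [simp]:
  "a < n \<Longrightarrow> b < n \<Longrightarrow> mat_sum n F I $$ (a, b) = (\<Sum>i\<in>I. F i $$ (a, b))"
  by (simp add: mat_sum_def)

lemma mat_sum_dim [simp]: "dim_row (mat_sum n F I) = n" "dim_col (mat_sum n F I) = n"
  by (simp_all add: mat_sum_def)

lemma mat_sum_symmetric:
  assumes "\<And>i. i \<in> I \<Longrightarrow> F i \<in> carrier_mat n n \<and> transpose_mat (F i) = F i"
  shows "transpose_mat (mat_sum n F I) = mat_sum n F I"
proof (rule eq_matI)
  fix a b assume ab: "a < dim_row (mat_sum n F I)" "b < dim_col (mat_sum n F I)"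
  have "F i $$ (b, a) = F i $$ (a, b)" if "i \<in> I" for i
    using assms[OF that] ab index_transpose_mat(1)[of a "F i" b] by auto
  then show "transpose_mat (mat_sum n F I) $$ (a, b) = mat_sum n F I $$ (a, b)"
    using ab by simp
qed auto

lemma bilin_mat_sum:
  assumes "\<And>i. i \<in> I \<Longrightarrow> F i \<in> carrier_mat n n" "u \<in> carrier_vec n" "v \<in> carrier_vec n"
  shows "bilin (mat_sum n F I) u v = (\<Sum>i\<in>I. bilin (F i) u v)"
proof -
  have "bilin (mat_sum n F I) u v = (\<Sum>a<n. \<Sum>b<n. \<Sum>i\<in>I. F i $$ (a, b) * (u $ a * v $ b))"
    using assms(2,3) by (simp add: bilin_eq_sum[of _ n] sum_distrib_right)
  also have "\<dots> = (\<Sum>a<n. \<Sum>i\<in>I. \<Sum>b<n. F i $$ (a, b) * (u $ a * v $ b))"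
    by (intro sum.cong refl sum.swap)
  also have "\<dots> = (\<Sum>i\<in>I. \<Sum>a<n. \<Sum>b<n. F i $$ (a, b) * (u $ a * v $ b))"
    by (rule sum.swap)
  also have "\<dots> = (\<Sum>i\<in>I. bilin (F i) u v)"
    using assms by (intro sum.cong refl) (simp add: bilin_eq_sum[of _ n])
  finally show ?thesis .
qed

lemma bilin_congruence:
  assumes "X \<in> carrier_mat n n" "B \<in> carrier_mat n n" "u \<in> carrier_vec n" "v \<in> carrier_vec n"
  shows "bilin (transpose_mat B * X * B) u v = bilin X (B *\<^sub>v u) (B *\<^sub>v v)"
proof -
  have "transpose_mat B * X * B *\<^sub>v v = transpose_mat B *\<^sub>v (X *\<^sub>v (B *\<^sub>v v))"
    using assms by (simp add: assoc_mult_mat_vec[of _ n n _ n])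
  moreover have "u \<bullet> (transpose_mat B *\<^sub>v (X *\<^sub>v (B *\<^sub>v v))) = (B *\<^sub>v u) \<bullet> (X *\<^sub>v (B *\<^sub>v v))"
    using assms transpose_vec_mult_scalar[of "transpose_mat B" n n "X *\<^sub>v (B *\<^sub>v v)" u] by simp
  ultimately show ?thesis by (simp add: bilin_def)
qed

lemma congruence_carrier:
  assumes "X \<in> carrier_mat n n" "B \<in> carrier_mat n n"
  shows "transpose_mat B * X * B \<in> carrier_mat n n"
  using assms by (intro mult_carrier_mat[of _ n n]) auto

lemma congruence_symmetric:
  assumes "X \<in> carrier_mat n n" "transpose_mat X = X" "B \<in> carrier_mat n n"
  shows "transpose_mat (transpose_mat B * X * B) = transpose_mat B * X * (B :: real mat)"
  using assms by (simp add: transpose_mult[of _ n n _ n] assoc_mult_mat[of _ n n _ n _ n])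

lemma transpose_smult_mat: "transpose_mat (c \<cdot>\<^sub>m X) = c \<cdot>\<^sub>m transpose_mat X"
  by (rule eq_matI) auto

lemma weighted_congruence_symmetric:
  fixes X B :: "real mat"
  assumes "X \<in> carrier_mat n n" "transpose_mat X = X" "B \<in> carrier_mat n n"
  shows "transpose_mat (c \<cdot>\<^sub>m (transpose_mat B * X * B)) = c \<cdot>\<^sub>m (transpose_mat B * X * B)"
  unfolding transpose_smult_mat congruence_symmetric[OF assms] ..

lemma pos_def_mat_iff:
  "pos_def_mat n X \<longleftrightarrow> X \<in> carrier_mat n n \<and> transpose_mat X = X \<and>
     (\<forall>v\<in>carrier_vec n. v \<noteq> 0\<^sub>v n \<longrightarrow> 0 < bilin X v v)"
  by (simp add: pos_def_mat_def bilin_def)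

lemma pos_def_mat_nonneg:
  assumes "pos_def_mat n X" "v \<in> carrier_vec n"
  shows "0 \<le> bilin X v v"
proof (cases "v = 0\<^sub>v n")
  case True
  then show ?thesis using assms by (simp add: bilin_eq_sum[of _ n] pos_def_mat_def)
next
  case False
  then show ?thesis using assms by (force simp: pos_def_mat_iff)
qed

lemma pos_def_mat_sum:
  assumes "finite J" "J \<noteq> {}" "\<And>i. i \<in> J \<Longrightarrow> pos_def_mat n (R i)"
  shows "pos_def_mat n (mat_sum n R J)"
  unfolding pos_def_mat_iff
proof (intro conjI ballI impI)
  show "transpose_mat (mat_sum n R J) = mat_sum n R J"
    using assms by (intro mat_sum_symmetric) (auto simp: pos_def_mat_def)
  fix v :: "real vec" assume "v \<in> carrier_vec n" "v \<noteq> 0\<^sub>v n"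
  then show "0 < bilin (mat_sum n R J) v v"
    using assms by (subst bilin_mat_sum) (auto simp: pos_def_mat_iff intro!: sum_pos)
qed simp

lemma neg_def_mat_diff:
  assumes "X \<in> carrier_mat n n" "Y \<in> carrier_mat n n"
  shows "neg_def_mat n (X - Y) \<longleftrightarrow> pos_def_mat n (Y - X)"
proof -
  have "- (X - Y) = Y - X" using assms by (intro eq_matI) auto
  then show ?thesis by (simp add: neg_def_mat_def)
qed

lemma neg_def_mat_diff_iff:
  assumes "X \<in> carrier_mat n n" "transpose_mat X = X" "Y \<in> carrier_mat n n" "transpose_mat Y = Y"
  shows "neg_def_mat n (X - Y) \<longleftrightarrow>
    (\<forall>v\<in>carrier_vec n. v \<noteq> 0\<^sub>v n \<longrightarrow> bilin X v v < bilin Y v v)"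
  using assms
  by (auto simp: neg_def_mat_diff pos_def_mat_iff minus_carrier_mat transpose_minus[of _ n n] bilin_diff[of _ n])

lemma scalar_prod_self_nonneg:
  "0 \<le> v \<bullet> (v :: real vec)"
  by (simp add: scalar_prod_def sum_nonneg)

lemma scalar_prod_self_pos:
  assumes "v \<in> carrier_vec n" "v \<noteq> 0\<^sub>v n"
  shows "0 < v \<bullet> (v :: real vec)"
proof -
  obtain i where "i < n" "v $ i \<noteq> 0"
    using assms by (metis carrier_vecD eq_vecI index_zero_vec)
  then show ?thesis
    using assms by (auto simp: scalar_prod_def zero_less_mult_iff intro!: sum_pos2[of _ i])
qed

text \<open>The crude constant, the sum of all absolute entries, suffices: it tends to zero with the entries, and
  the arithmetic mean of the squared norms is the shape that survives the substitution of
  \<open>A\<^sub>i u\<close> and \<open>A\<^sub>i v\<close> without square roots.\<close>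

lemma abs_bilin_le:
  assumes "X \<in> carrier_mat n n" "u \<in> carrier_vec n" "v \<in> carrier_vec n"
  shows "\<bar>bilin X u v\<bar> \<le> (\<Sum>a<n. \<Sum>b<n. \<bar>X $$ (a, b)\<bar>) * ((u \<bullet> u + v \<bullet> v) / 2)"
proof -
  have sq: "(w $ a)\<^sup>2 \<le> w \<bullet> w" if "w \<in> carrier_vec n" "a < n" for w :: "real vec" and a
    using that member_le_sum[of a "{0..<n}" "\<lambda>a. w $ a * w $ a"]
    by (simp add: scalar_prod_def power2_eq_square)
  have "\<bar>u $ a * v $ b\<bar> \<le> (u \<bullet> u + v \<bullet> v) / 2" if "a < n" "b < n" for a b
    using sq[OF assms(2) that(1)] sq[OF assms(3) that(2)]
      sum_squares_bound[of "\<bar>u $ a\<bar>" "\<bar>v $ b\<bar>"] by (simp add: abs_mult)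
  then have "(\<Sum>a<n. \<Sum>b<n. \<bar>X $$ (a, b)\<bar> * \<bar>u $ a * v $ b\<bar>)
      \<le> (\<Sum>a<n. \<Sum>b<n. \<bar>X $$ (a, b)\<bar> * ((u \<bullet> u + v \<bullet> v) / 2))"
    by (intro sum_mono mult_left_mono) auto
  moreover have "\<bar>bilin X u v\<bar> \<le> (\<Sum>a<n. \<Sum>b<n. \<bar>X $$ (a, b)\<bar> * \<bar>u $ a * v $ b\<bar>)"
    unfolding bilin_eq_sum[OF assms]
    by (rule order_trans[OF sum_abs sum_mono[OF order_trans[OF sum_abs]]]) (simp add: abs_mult)
  ultimately show ?thesis unfolding sum_distrib_right by (rule order_trans[rotated])
qed

lemma bilin_add_right:
  assumes "X \<in> carrier_mat n n" "u \<in> carrier_vec n" "v \<in> carrier_vec n" "w \<in> carrier_vec n"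
  shows "bilin X u (v + c \<cdot>\<^sub>v w) = bilin X u v + c * bilin X u w"
  using assms by (simp add: bilin_eq_sum[of _ n] sum.distrib sum_distrib_left algebra_simps)

lemma bilin_add_left:
  assumes "X \<in> carrier_mat n n" "u \<in> carrier_vec n" "v \<in> carrier_vec n" "w \<in> carrier_vec n"
  shows "bilin X (v + c \<cdot>\<^sub>v w) u = bilin X v u + c * bilin X w u"
  using assms by (simp add: bilin_eq_sum[of _ n] sum.distrib sum_distrib_left algebra_simps)

text \<open>The form is nonnegative at \<open>u + c v\<close>; the value of \<open>c\<close> below minimises it.\<close>

lemma pos_def_Cauchy_Schwarz:
  assumes "pos_def_mat n X" "u \<in> carrier_vec n" "v \<in> carrier_vec n"
  shows "(bilin X u v)\<^sup>2 \<le> bilin X u u * bilin X v v"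
proof (cases "v = 0\<^sub>v n")
  case True
  then show ?thesis using assms by (simp add: bilin_eq_sum[of _ n] pos_def_mat_def)
next
  case False
  have X: "X \<in> carrier_mat n n" and sym: "transpose_mat X = X" and pos: "0 < bilin X v v"
    using assms False by (auto simp: pos_def_mat_iff)
  define c where "c = - bilin X u v / bilin X v v"
  have "0 \<le> bilin X (u + c \<cdot>\<^sub>v v) (u + c \<cdot>\<^sub>v v)"
    using assms by (intro pos_def_mat_nonneg) auto
  also have "\<dots> = bilin X u u + 2 * c * bilin X u v + c\<^sup>2 * bilin X v v"
    using assms X bilin_commute[OF X sym assms(2,3)]
    by (simp add: bilin_add_right[of _ n] bilin_add_left[of _ n] power2_eq_square algebra_simps)
  also have "\<dots> = bilin X u u - (bilin X u v)\<^sup>2 / bilin X v v"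
    using pos by (simp add: c_def power2_eq_square field_simps)
  finally show ?thesis using pos by (simp add: field_simps)
qed

text \<open>A positive definite form dominates a positive multiple of the squared norm. In place of compactness,
  write \<open>v = X w\<close>: Cauchy-Schwarz for \<open>X\<close> bounds \<open>(v \<bullet> v)\<^sup>2\<close> by \<open>v\<^sup>T X v\<close> times \<open>w\<^sup>T X w\<close>, and
  \<open>w\<^sup>T X w = v\<^sup>T X\<^sup>-\<^sup>1 v\<close> is at most a constant times \<open>v \<bullet> v\<close>.\<close>

lemma pos_def_coercive:
  assumes "pos_def_mat n X"
  obtains e where "e > 0" "\<And>v. v \<in> carrier_vec n \<Longrightarrow> e * (v \<bullet> v) \<le> bilin X v v"
proof -
  have X: "X \<in> carrier_mat n n" using assms by (simp add: pos_def_mat_def)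
  have "det X \<noteq> 0"
  proof
    assume "det X = 0"
    then obtain v where "v \<in> carrier_vec n" "v \<noteq> 0\<^sub>v n" "X *\<^sub>v v = 0\<^sub>v n"
      using det_0_iff_vec_prod_zero_field[OF X] by blast
    with assms show False by (auto simp: pos_def_mat_def)
  qed
  then obtain Y where Y: "Y \<in> carrier_mat n n" and XY: "X * Y = 1\<^sub>m n"
    using det_non_zero_imp_unit[OF X, of "()"] by (auto simp: Units_def ring_mat_def)
  \<comment> \<open>The summand 1 keeps the constant positive in dimension zero.\<close>
  define C where "C = 1 + (\<Sum>a<n. \<Sum>b<n. \<bar>Y $$ (a, b)\<bar>)"
  have C: "C > 0" unfolding C_def by (intro add_pos_nonneg sum_nonneg) auto
  show thesis
  proof
    show "1 / C > 0" using C by simp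
    fix v :: "real vec" assume v: "v \<in> carrier_vec n"
    define w where "w = Y *\<^sub>v v"
    have w: "w \<in> carrier_vec n" using Y v by (simp add: w_def)
    have Xw: "X *\<^sub>v w = v"
      using X Y v XY by (simp add: w_def flip: assoc_mult_mat_vec[of _ n n _ n])
    have "bilin X w w = bilin Y v v"
      using Xw v w by (simp add: bilin_def comm_scalar_prod[OF w v] flip: w_def)
    also have "\<dots> \<le> C * (v \<bullet> v)"
      using abs_bilin_le[OF Y v v] scalar_prod_self_nonneg[of v] by (simp add: C_def algebra_simps)
    finally have ww: "bilin X w w \<le> C * (v \<bullet> v)" .
    have "(v \<bullet> v)\<^sup>2 = (bilin X v w)\<^sup>2" using Xw by (simp add: bilin_def)
    also have "\<dots> \<le> bilin X v v * bilin X w w" by (rule pos_def_Cauchy_Schwarz[OF assms v w])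
    also have "\<dots> \<le> bilin X v v * (C * (v \<bullet> v))"
      using ww pos_def_mat_nonneg[OF assms v] by (intro mult_left_mono)
    finally have *: "(v \<bullet> v) * (v \<bullet> v) \<le> (C * bilin X v v) * (v \<bullet> v)"
      by (simp add: power2_eq_square mult_ac)
    show "1 / C * (v \<bullet> v) \<le> bilin X v v"
    proof (cases "v \<bullet> v = 0")
      case True
      then show ?thesis using pos_def_mat_nonneg[OF assms v] by simp
    next
      case False
      then have "v \<bullet> v \<le> C * bilin X v v"
        using * scalar_prod_self_nonneg[of v] mult_right_le_imp_le by fastforce
      then show ?thesis using C by (simp add: field_simps)
    qed
  qed
qed

section \<open>Vanishing powers and the spectral radius\<close>

lemma pow_smult_mat:
  assumes "M \<in> carrier_mat n n"
  shows "(c \<cdot>\<^sub>m M) ^\<^sub>m k = c ^ k \<cdot>\<^sub>m (M ^\<^sub>m k :: 'a :: comm_ring_1 mat)"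
proof (induction k)
  case (Suc k)
  then show ?case
    using assms pow_carrier_mat[OF assms, of k]
    by (simp add: mult_smult_distrib[of _ n n _ n] mult_smult_assoc_mat[of _ n n _ n] ) (auto intro!: eq_matI)
qed (use assms in \<open>auto intro!: eq_matI\<close>)

lemma spectrum_smult:
  assumes "M \<in> carrier_mat n n" "c \<noteq> (0 :: 'a :: field)"
  shows "spectrum (c \<cdot>\<^sub>m M) = (\<lambda>k. c * k) ` spectrum M"
proof -
  have "eigenvalue (c \<cdot>\<^sub>m M) k \<longleftrightarrow> eigenvalue M (k / c)" for k
  proof -
    have "(c \<cdot>\<^sub>m M) *\<^sub>v v = k \<cdot>\<^sub>v v \<longleftrightarrow> M *\<^sub>v v = (k / c) \<cdot>\<^sub>v v" if v: "v \<in> carrier_vec n" for v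
    proof -
      have "(c \<cdot>\<^sub>m M) *\<^sub>v v = c \<cdot>\<^sub>v (M *\<^sub>v v)"
        using assms v by (intro eq_vecI) (auto simp: scalar_prod_def sum_distrib_left mult_ac)
      moreover have "c \<cdot>\<^sub>v x = k \<cdot>\<^sub>v v \<longleftrightarrow> x = (k / c) \<cdot>\<^sub>v v" if "x \<in> carrier_vec n" for x
        using that v assms(2) by (auto simp: vec_eq_iff field_simps)
      ultimately show ?thesis using assms v by simp
    qed
    then show ?thesis using assms by (auto simp: eigenvalue_def eigenvector_def)
  qed
  then show ?thesis using assms(2) by (force simp: spectrum_def image_iff)
qed

lemma spectral_radius_smult:
  assumes M: "M \<in> carrier_mat n n" and "n > 0" "c > 0"
  shows "spectral_radius (complex_of_real c \<cdot>\<^sub>m M) = c * spectral_radius M"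
proof -
  have "norm ` spectrum (complex_of_real c \<cdot>\<^sub>m M) = (\<lambda>x. c * x) ` norm ` spectrum M"
    using assms by (simp add: spectrum_smult[OF M] image_image norm_mult)
  moreover have "finite (norm ` spectrum M)" "norm ` spectrum M \<noteq> {}"
    using card_finite_spectrum(1)[OF M] spectrum_non_empty[OF M] assms(2) by auto
  moreover have "mono (\<lambda>x. c * x)" using assms(3) by (auto intro!: monoI)
  ultimately show ?thesis
    unfolding spectral_radius_def by (simp add: mono_Max_commute)
qed

lemma spectral_radius_nonneg:
  assumes "M \<in> carrier_mat n n" "n > 0"
  shows "0 \<le> spectral_radius M"
  using spectral_radius_mem_max(1)[OF assms] by auto

lemma tendsto_0_if_norm_le:
  fixes g :: "nat \<Rightarrow> 'a :: real_normed_vector"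
  assumes "f \<longlonglongrightarrow> 0" "\<And>k. norm (g k) \<le> f k"
  shows "g \<longlonglongrightarrow> 0"
  using assms(1)
  by (rule tendsto_0_le[where K = 1])
    (auto intro!: always_eventually order_trans[OF assms(2)])

text \<open>The Jordan normal form bounds the powers of a matrix of spectral radius below one. Decay comes from
  applying this bound to \<open>M / s\<close> for some \<open>s\<close> between the spectral radius and one. For the
  converse, the powers act on an eigenvector of maximal eigenvalue \<open>z\<close> as \<open>z\<^sup>k\<close>.\<close>

lemma spectral_radius_less_1_iff_powers_tendsto_0:
  assumes M: "M \<in> carrier_mat n n" and n: "n > 0"
  shows "spectral_radius M < 1 \<longleftrightarrow> (\<forall>i<n. \<forall>j<n. (\<lambda>k. (M ^\<^sub>m k) $$ (i, j)) \<longlonglongrightarrow> 0)"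
proof
  assume less: "spectral_radius M < 1"
  define s where "s = (spectral_radius M + 1) / 2"
  have s: "0 < s" "s < 1" "spectral_radius M < s"
    using less spectral_radius_nonneg[OF M n] by (auto simp: s_def)
  define M' where "M' = complex_of_real (1 / s) \<cdot>\<^sub>m M"
  have M': "M' \<in> carrier_mat n n" using M by (simp add: M'_def)
  have "spectral_radius M' < 1"
    unfolding M'_def using s by (subst spectral_radius_smult[OF M n]) auto
  then obtain c where c: "\<And>k. norm_bound (M' ^\<^sub>m k) c"
    using spectral_radius_jnf_norm_bound_less_1_upper_triangular[OF M'] by blast
  have bound: "norm ((M ^\<^sub>m k) $$ (i, j)) \<le> c * s ^ k" if "i < n" "j < n" for i j k
  proof -
    have "norm ((M' ^\<^sub>m k) $$ (i, j)) \<le> c"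
      using c[of k] that pow_carrier_mat[OF M', of k] M'
      by (metis carrier_matD norm_bound_def)
    moreover have "(M' ^\<^sub>m k) $$ (i, j) = complex_of_real (1 / s) ^ k * (M ^\<^sub>m k) $$ (i, j)"
      unfolding M'_def pow_smult_mat[OF M]
      using that carrier_matD[OF pow_carrier_mat[OF M, of k]] by (intro index_smult_mat(1)) auto
    ultimately show ?thesis
      using s by (simp add: norm_mult norm_power norm_divide field_simps)
  qed
  have "(\<lambda>k. c * s ^ k) \<longlonglongrightarrow> 0"
    using s by (intro tendsto_mult_right_zero LIMSEQ_realpow_zero) auto
  then show "\<forall>i<n. \<forall>j<n. (\<lambda>k. (M ^\<^sub>m k) $$ (i, j)) \<longlonglongrightarrow> 0"
    using bound by (auto intro: tendsto_0_if_norm_le)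
next
  assume lim: "\<forall>i<n. \<forall>j<n. (\<lambda>k. (M ^\<^sub>m k) $$ (i, j)) \<longlonglongrightarrow> 0"
  obtain z where z: "z \<in> spectrum M" and rz: "spectral_radius M = norm z"
    using spectral_radius_mem_max(1)[OF M n] by auto
  then obtain v where ev: "eigenvector M v z"
    by (auto simp: spectrum_def eigenvalue_def)
  then have v: "v \<in> carrier_vec n" "v \<noteq> 0\<^sub>v n" using M by (auto simp: eigenvector_def)
  then obtain i where i: "i < n" "v $ i \<noteq> 0"
    by (metis carrier_vecD eq_vecI index_zero_vec)
  have "z ^ k * v $ i = (\<Sum>j\<in>{0..<n}. (M ^\<^sub>m k) $$ (i, j) * v $ j)" for k
  proof -
    have "z ^ k * v $ i = (M ^\<^sub>m k *\<^sub>v v) $ i"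
      using eigenvector_pow[OF M ev, of k] v i by simp
    also have "\<dots> = (\<Sum>j\<in>{0..<n}. (M ^\<^sub>m k) $$ (i, j) * v $ j)"
      using v i M by (auto simp: scalar_prod_def intro!: sum.cong)
    finally show ?thesis .
  qed
  moreover have "(\<lambda>k. \<Sum>j\<in>{0..<n}. (M ^\<^sub>m k) $$ (i, j) * v $ j) \<longlonglongrightarrow> 0"
    using lim i by (intro tendsto_null_sum tendsto_mult_left_zero) auto
  ultimately have "(\<lambda>k. z ^ k * v $ i) \<longlonglongrightarrow> 0" by simp
  then have "(\<lambda>k. norm (z ^ k * v $ i)) \<longlonglongrightarrow> 0"
    by (rule tendsto_norm_zero)
  then have "(\<lambda>k. norm z ^ k) \<longlonglongrightarrow> 0"
    using i by (simp add: norm_mult norm_power)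
  then have "\<forall>\<^sub>F k in sequentially. norm z ^ k < 1"
    by (rule order_tendstoD) simp
  then obtain k where "norm z ^ k < 1"
    using eventually_happens'[OF sequentially_bot] by blast
  then show "spectral_radius M < 1"
    unfolding rz by (meson linorder_not_less one_le_power)
qed

lemma real_spectral_radius_less_1_iff_powers_tendsto_0:
  assumes M: "M \<in> carrier_mat n n" and n: "n > 0"
  shows "spectral_radius (map_mat complex_of_real M) < 1 \<longleftrightarrow>
    (\<forall>i<n. \<forall>j<n. (\<lambda>k. (M ^\<^sub>m k) $$ (i, j)) \<longlonglongrightarrow> 0)"
proof -
  have "(map_mat complex_of_real M ^\<^sub>m k) $$ (i, j) = complex_of_real ((M ^\<^sub>m k) $$ (i, j))"
    if "i < n" "j < n" for i j k
    using of_real_hom.mat_hom_pow[OF M, of k] pow_carrier_mat[OF M, of k] that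
    by (metis carrier_matD index_map_mat(1))
  then show ?thesis
    using spectral_radius_less_1_iff_powers_tendsto_0[of "map_mat complex_of_real M" n] M n
    by (simp add: tendsto_of_real_iff[where c = 0, simplified])
qed

section \<open>The Lyapunov operator and its Kronecker matrix\<close>

lemma mult_unit_vec:
  fixes B :: "real mat"
  assumes "B \<in> carrier_mat n n" "j < n"
  shows "B *\<^sub>v unit_vec n j = col B j"
  using assms by (intro eq_vecI) auto

lemma kronecker_square:
  assumes "B \<in> carrier_mat n n"
  shows "B \<otimes>\<^sub>K B \<in> carrier_mat (n * n) (n * n)"
    and "r < n * n \<Longrightarrow> s < n * n \<Longrightarrow>
      (B \<otimes>\<^sub>K B) $$ (r, s) = B $$ (r div n, s div n) * B $$ (r mod n, s mod n)"
  using carrier_matD[OF assms] by (simp_all add: kronecker_def)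

text \<open>Row-major numbering of index pairs, the numbering used by the Kronecker product.\<close>

lemma sum_div_mod:
  fixes n :: nat
  shows "(\<Sum>r<n * n. f (r div n) (r mod n)) = (\<Sum>c<n. \<Sum>d<n. f c d :: real)"
proof -
  have less: "c * n + d < n * n" if "c < n" "d < n" for c d
  proof -
    have "c * n + d < Suc c * n" using that by simp
    also have "\<dots> \<le> n * n" using that by (intro mult_le_mono1) simp
    finally show ?thesis .
  qed
  have "(\<Sum>r<n * n. f (r div n) (r mod n)) = (\<Sum>(c, d)\<in>{..<n} \<times> {..<n}. f c d)"
    using mod_less_divisor[of n] gr0I[of n]
    by (intro sum.reindex_bij_witness[where i = "\<lambda>(c, d). c * n + d" and j = "\<lambda>r. (r div n, r mod n)"])
      (fastforce simp: less_mult_imp_div_less less)+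
  then show ?thesis by (simp add: sum.cartesian_product)
qed

text \<open>\<open>Lyap\<close> is the operator \<open>L\<close> of the introduction, for arbitrary nonnegative weights; \<open>Kron\<close> is the
  matrix \<open>M\<close> whose transpose represents it on vectorised matrices.\<close>

locale lyapunov_operator =
  fixes n :: nat and I :: "'i set" and w :: "'i \<Rightarrow> real" and A :: "'i \<Rightarrow> real mat"
  assumes A: "i \<in> I \<Longrightarrow> A i \<in> carrier_mat n n"
    and w: "i \<in> I \<Longrightarrow> 0 \<le> w i"
begin

definition Lyap :: "real mat \<Rightarrow> real mat" where
  "Lyap X = mat_sum n (\<lambda>i. w i \<cdot>\<^sub>m (transpose_mat (A i) * X * A i)) I"

definition Kron :: "real mat" where
  "Kron = mat_sum (n * n) (\<lambda>i. w i \<cdot>\<^sub>m (A i \<otimes>\<^sub>K A i)) I"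

lemma Lyap_carrier [simp]: "Lyap X \<in> carrier_mat n n"
  by (simp add: Lyap_def)

lemma Kron_carrier [simp]: "Kron \<in> carrier_mat (n * n) (n * n)"
  by (simp add: Kron_def)

lemma bilin_Lyap:
  assumes "X \<in> carrier_mat n n" "u \<in> carrier_vec n" "v \<in> carrier_vec n"
  shows "bilin (Lyap X) u v = (\<Sum>i\<in>I. w i * bilin X (A i *\<^sub>v u) (A i *\<^sub>v v))"
  unfolding Lyap_def using assms A
  by (subst bilin_mat_sum) (auto simp: bilin_smult[of _ n] bilin_congruence[of _ n] congruence_carrier intro!: sum.cong)

lemma Lyap_symmetric:
  assumes "X \<in> carrier_mat n n" "transpose_mat X = X"
  shows "transpose_mat (Lyap X) = Lyap X"
  unfolding Lyap_def using assms A
  by (intro mat_sum_symmetric) (auto simp: congruence_carrier intro: weighted_congruence_symmetric)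

lemma Lyap_nonneg:
  assumes "X \<in> carrier_mat n n" "\<And>v. v \<in> carrier_vec n \<Longrightarrow> 0 \<le> bilin X v v" "v \<in> carrier_vec n"
  shows "0 \<le> bilin (Lyap X) v v"
  using assms A w by (auto simp: bilin_Lyap intro!: sum_nonneg mult_nonneg_nonneg mult_mat_vec_carrier[of _ n n])

lemma Lyap_funpow_carrier:
  "X \<in> carrier_mat n n \<Longrightarrow> (Lyap ^^ k) X \<in> carrier_mat n n"
  by (cases k) auto

definition flatten :: "real mat \<Rightarrow> real vec" where
  "flatten X = vec (n * n) (\<lambda>r. X $$ (r div n, r mod n))"

lemma flatten_carrier [simp]: "flatten X \<in> carrier_vec (n * n)"
  by (simp add: flatten_def)

text \<open>The entry of \<open>A\<^sup>T X A\<close> at \<open>(a, b)\<close> is the form of \<open>X\<close> at the columns \<open>a\<close> and \<open>b\<close> of \<open>A\<close>, in which the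
  coefficient of \<open>X $$ (c, d)\<close> is an entry of the Kronecker square of \<open>A\<close> with row \<open>(c, d)\<close> and column
  \<open>(a, b)\<close>. The sum thus runs over the row index, whence the transpose.\<close>

lemma flatten_Lyap:
  assumes X: "X \<in> carrier_mat n n"
  shows "flatten (Lyap X) = transpose_mat Kron *\<^sub>v flatten X"
proof (rule eq_vecI)
  fix s assume "s < dim_vec (transpose_mat Kron *\<^sub>v flatten X)"
  then have s: "s < n * n" by (simp add: Kron_def)
  then have n: "n > 0" by (auto intro: gr0I)
  have ab: "s div n < n" "s mod n < n" using s n by (auto simp: less_mult_imp_div_less)
  have "flatten (Lyap X) $ s = bilin (Lyap X) (unit_vec n (s div n)) (unit_vec n (s mod n))"
    using s ab by (simp add: flatten_def bilin_unit_vec[of _ n])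
  also have "\<dots> = (\<Sum>i\<in>I. w i * bilin X (col (A i) (s div n)) (col (A i) (s mod n)))"
    using X A ab by (subst bilin_Lyap) (auto simp: mult_unit_vec intro!: sum.cong)
  also have "\<dots> = (\<Sum>i\<in>I. w i * (\<Sum>c<n. \<Sum>d<n. X $$ (c, d) *
      (A i $$ (c, s div n) * A i $$ (d, s mod n))))"
    using X A ab by (intro sum.cong refl) (simp add: bilin_eq_sum[of _ n] carrier_vecI carrier_matD[of _ n n])
  also have "\<dots> = (\<Sum>i\<in>I. \<Sum>r<n * n. X $$ (r div n, r mod n) *
      (w i * (A i $$ (r div n, s div n) * A i $$ (r mod n, s mod n))))"
    unfolding sum_div_mod[of "\<lambda>c d. X $$ (c, d) * (A _ $$ (c, _) * A _ $$ (d, _))", symmetric]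
    by (simp add: sum_distrib_left mult_ac)
  also have "\<dots> = (\<Sum>r<n * n. X $$ (r div n, r mod n) *
      (\<Sum>i\<in>I. w i * (A i $$ (r div n, s div n) * A i $$ (r mod n, s mod n))))"
    by (subst sum.swap) (simp add: sum_distrib_left)
  also have "\<dots> = (\<Sum>r<n * n. X $$ (r div n, r mod n) * Kron $$ (r, s))"
  proof (intro sum.cong refl arg_cong2[of _ _ _ _ "(*)"])
    fix r assume "r \<in> {..<n * n}"
    then show "(\<Sum>i\<in>I. w i * (A i $$ (r div n, s div n) * A i $$ (r mod n, s mod n))) = Kron $$ (r, s)"
      using s carrier_matD[OF kronecker_square(1)[OF A]] kronecker_square(2)[OF A]
      by (auto simp: Kron_def intro!: sum.cong)
  qed
  also have "\<dots> = (transpose_mat Kron *\<^sub>v flatten X) $ s"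
    using s by (simp add: Kron_def flatten_def scalar_prod_def lessThan_atLeast0 mult.commute)
  finally show "flatten (Lyap X) $ s = (transpose_mat Kron *\<^sub>v flatten X) $ s" .
qed (simp add: flatten_def Kron_def)

lemma flatten_Lyap_funpow:
  assumes "X \<in> carrier_mat n n"
  shows "flatten ((Lyap ^^ k) X) = transpose_mat (Kron ^\<^sub>m k) *\<^sub>v flatten X"
proof (induction k)
  case 0
  then show ?case using Kron_carrier by (simp add: Kron_def transpose_one)
next
  case (Suc k)
  note Kk = pow_carrier_mat[OF Kron_carrier, of k]
  have "flatten ((Lyap ^^ Suc k) X) = transpose_mat Kron *\<^sub>v (transpose_mat (Kron ^\<^sub>m k) *\<^sub>v flatten X)"
    using flatten_Lyap[OF Lyap_funpow_carrier[OF assms]] Suc by simp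
  also have "\<dots> = transpose_mat (Kron ^\<^sub>m k * Kron) *\<^sub>v flatten X"
    using Kk by (simp add: transpose_mult[OF Kk Kron_carrier] assoc_mult_mat_vec[of _ "n * n" "n * n" _ "n * n"])
  finally show ?case by simp
qed

section \<open>Solvability of the Lyapunov inequality\<close>

text \<open>The gap \<open>Q - Lyap Q\<close> dominates a multiple of the squared norm, and the squared norm dominates a
  multiple of \<open>Q\<close>.\<close>

lemma Lyap_strict_contraction:
  assumes Q: "pos_def_mat n Q" and LQ: "neg_def_mat n (Lyap Q - Q)"
  obtains \<alpha> where "0 \<le> \<alpha>" "\<alpha> < 1"
    "\<And>v. v \<in> carrier_vec n \<Longrightarrow> bilin (Lyap Q) v v \<le> \<alpha> * bilin Q v v"
proof -
  have Qc: "Q \<in> carrier_mat n n" and Qs: "transpose_mat Q = Q"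
    using Q by (auto simp: pos_def_mat_def)
  have "pos_def_mat n (Q - Lyap Q)" using LQ Qc by (simp add: neg_def_mat_diff)
  then obtain e where e: "e > 0"
    and gap: "\<And>v. v \<in> carrier_vec n \<Longrightarrow> e * (v \<bullet> v) \<le> bilin (Q - Lyap Q) v v"
    using pos_def_coercive by blast
  define S where "S = (\<Sum>a<n. \<Sum>b<n. \<bar>Q $$ (a, b)\<bar>)"
  have S: "S \<ge> 0" unfolding S_def by (intro sum_nonneg) auto
  show thesis
  proof
    \<comment> \<open>The upper bound for Q is enlarged from S to S + e, which keeps the ratio below one and nonnegative.\<close>
    show "0 \<le> S / (S + e)" "S / (S + e) < 1" using S e by auto
    fix v :: "real vec" assume v: "v \<in> carrier_vec n"
    have "bilin Q v v \<le> S * (v \<bullet> v)"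
      using abs_bilin_le[OF Qc v v] by (simp add: S_def)
    also have "\<dots> \<le> (S + e) * (v \<bullet> v)"
      using e scalar_prod_self_nonneg[of v] by (simp add: algebra_simps)
    finally have "e / (S + e) * bilin Q v v \<le> e / (S + e) * ((S + e) * (v \<bullet> v))"
      using S e by (intro mult_left_mono) auto
    also have "\<dots> = e * (v \<bullet> v)" using S e by simp
    also have "\<dots> \<le> bilin Q v v - bilin (Lyap Q) v v"
      using gap[OF v] v Qc by (simp add: bilin_diff[of _ n])
    finally have "bilin (Lyap Q) v v \<le> (1 - e / (S + e)) * bilin Q v v"
      by (simp add: algebra_simps)
    also have "1 - e / (S + e) = S / (S + e)" using S e by (simp add: field_simps)
    finally show "bilin (Lyap Q) v v \<le> S / (S + e) * bilin Q v v" .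
  qed
qed

text \<open>Both sides of the bound transform in the same way: \<open>Lyap\<close> replaces \<open>u\<close>, \<open>v\<close> by \<open>A\<^sub>i u\<close>, \<open>A\<^sub>i v\<close>
  and sums with nonnegative weights. On the right this produces \<open>Lyap Q\<close>, hence a factor \<open>\<alpha>\<close>.
  Bounding the bilinear form, not just the quadratic one, is what admits non-symmetric \<open>X\<close>.\<close>

lemma bilin_Lyap_funpow_decay:
  assumes Q: "Q \<in> carrier_mat n n" and X: "X \<in> carrier_mat n n" and C: "0 \<le> C" and \<alpha>: "0 \<le> \<alpha>"
    and LQ: "\<And>v. v \<in> carrier_vec n \<Longrightarrow> bilin (Lyap Q) v v \<le> \<alpha> * bilin Q v v"
    and bound: "\<And>u v. u \<in> carrier_vec n \<Longrightarrow> v \<in> carrier_vec n \<Longrightarrow>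
      \<bar>bilin X u v\<bar> \<le> C * (bilin Q u u + bilin Q v v)"
    and "u \<in> carrier_vec n" "v \<in> carrier_vec n"
  shows "\<bar>bilin ((Lyap ^^ k) X) u v\<bar> \<le> C * \<alpha> ^ k * (bilin Q u u + bilin Q v v)"
  using assms(7,8)
proof (induction k arbitrary: u v)
  case 0
  then show ?case using bound by simp
next
  case (Suc k)
  let ?Y = "(Lyap ^^ k) X"
  have Av: "A i *\<^sub>v x \<in> carrier_vec n" if "i \<in> I" "x \<in> carrier_vec n" for i x
    using A that by (intro mult_mat_vec_carrier) auto
  have "\<bar>bilin ((Lyap ^^ Suc k) X) u v\<bar> \<le> (\<Sum>i\<in>I. \<bar>w i * bilin ?Y (A i *\<^sub>v u) (A i *\<^sub>v v)\<bar>)"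
    using Suc.prems Lyap_funpow_carrier[OF X] by (simp add: bilin_Lyap sum_abs)
  also have "\<dots> \<le> (\<Sum>i\<in>I. w i * (C * \<alpha> ^ k *
      (bilin Q (A i *\<^sub>v u) (A i *\<^sub>v u) + bilin Q (A i *\<^sub>v v) (A i *\<^sub>v v))))"
    using Suc Av w by (intro sum_mono) (auto simp: abs_mult intro!: mult_left_mono)
  also have "\<dots> = C * \<alpha> ^ k * (bilin (Lyap Q) u u + bilin (Lyap Q) v v)"
    using Suc.prems Q by (simp add: bilin_Lyap sum_distrib_left sum.distrib algebra_simps)
  also have "\<dots> \<le> C * \<alpha> ^ k * (\<alpha> * bilin Q u u + \<alpha> * bilin Q v v)"
    using C \<alpha> LQ Suc.prems by (intro mult_left_mono add_mono) auto
  finally show ?case by (simp add: algebra_simps)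
qed

text \<open>Row \<open>r\<close> of \<open>Kron\<^sup>k\<close> is the vectorised \<open>k\<close>-th iterate of the matrix unit \<open>E\<close> numbered \<open>r\<close>.
  Coercivity of \<open>Q\<close> gives \<open>E\<close> the initial bound that the decay lemma asks for.\<close>

lemma Kron_powers_tendsto_0:
  assumes Q: "pos_def_mat n Q" and LQ: "neg_def_mat n (Lyap Q - Q)" and rs: "r < n * n" "s < n * n"
  shows "(\<lambda>k. (Kron ^\<^sub>m k) $$ (r, s)) \<longlonglongrightarrow> 0"
proof -
  have n: "n > 0" using rs by (auto intro: gr0I)
  have ab: "s div n < n" "s mod n < n" using rs n by (auto simp: less_mult_imp_div_less)
  have Qc: "Q \<in> carrier_mat n n" using Q by (simp add: pos_def_mat_def)
  obtain \<alpha> where \<alpha>: "0 \<le> \<alpha>" "\<alpha> < 1"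
    and contr: "\<And>v. v \<in> carrier_vec n \<Longrightarrow> bilin (Lyap Q) v v \<le> \<alpha> * bilin Q v v"
    using Lyap_strict_contraction[OF Q LQ] by blast
  obtain e where e: "e > 0" and coer: "\<And>v. v \<in> carrier_vec n \<Longrightarrow> e * (v \<bullet> v) \<le> bilin Q v v"
    using pos_def_coercive[OF Q] by blast
  define E :: "real mat" where "E = mat n n (\<lambda>(c, d). if c * n + d = r then 1 else 0)"
  have E: "E \<in> carrier_mat n n" by (simp add: E_def)
  have flatE: "flatten E = unit_vec (n * n) r"
    using n rs by (intro eq_vecI) (auto simp: flatten_def E_def less_mult_imp_div_less)
  have entry: "(Kron ^\<^sub>m k) $$ (r, s) = bilin ((Lyap ^^ k) E) (unit_vec n (s div n)) (unit_vec n (s mod n))" for k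
  proof -
    have "(Kron ^\<^sub>m k) $$ (r, s) = (transpose_mat (Kron ^\<^sub>m k) *\<^sub>v unit_vec (n * n) r) $ s"
      using rs carrier_matD[OF Kron_carrier] by simp
    also have "\<dots> = ((Lyap ^^ k) E) $$ (s div n, s mod n)"
      using rs by (simp flip: flatE flatten_Lyap_funpow[OF E]) (simp add: flatten_def)
    finally show ?thesis
      using bilin_unit_vec[OF Lyap_funpow_carrier[OF E] ab] by simp
  qed
  define S where "S = (\<Sum>a<n. \<Sum>b<n. \<bar>E $$ (a, b)\<bar>)"
  have S: "S \<ge> 0" unfolding S_def by (intro sum_nonneg) auto
  have bound: "\<bar>bilin E u v\<bar> \<le> S / (2 * e) * (bilin Q u u + bilin Q v v)"
    if uv: "u \<in> carrier_vec n" "v \<in> carrier_vec n" for u v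
  proof -
    have "\<bar>bilin E u v\<bar> \<le> S * ((u \<bullet> u + v \<bullet> v) / 2)"
      unfolding S_def by (rule abs_bilin_le[OF E uv])
    also have "\<dots> = S / (2 * e) * (e * (u \<bullet> u) + e * (v \<bullet> v))"
      using e by (simp add: field_simps)
    also have "\<dots> \<le> S / (2 * e) * (bilin Q u u + bilin Q v v)"
      using S e coer uv by (intro mult_left_mono add_mono) auto
    finally show ?thesis .
  qed
  define q where "q = bilin Q (unit_vec n (s div n)) (unit_vec n (s div n))
    + bilin Q (unit_vec n (s mod n)) (unit_vec n (s mod n))"
  have "\<bar>(Kron ^\<^sub>m k) $$ (r, s)\<bar> \<le> S / (2 * e) * \<alpha> ^ k * q" for k
    unfolding entry q_def
    by (rule bilin_Lyap_funpow_decay[OF Qc E _ \<alpha>(1) contr bound]) (use S e in auto)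
  moreover have "(\<lambda>k. S / (2 * e) * \<alpha> ^ k * q) \<longlonglongrightarrow> 0"
    using \<alpha> by (intro tendsto_mult_left_zero tendsto_mult_right_zero LIMSEQ_realpow_zero)
  ultimately show ?thesis by (auto intro: tendsto_0_if_norm_le)
qed

lemma Lyap_funpow_entries_tendsto_0:
  assumes lim: "\<And>r s. r < n * n \<Longrightarrow> s < n * n \<Longrightarrow> (\<lambda>k. (Kron ^\<^sub>m k) $$ (r, s)) \<longlonglongrightarrow> 0"
    and X: "X \<in> carrier_mat n n" and ab: "a < n" "b < n"
  shows "(\<lambda>k. ((Lyap ^^ k) X) $$ (a, b)) \<longlonglongrightarrow> 0"
proof -
  define s where "s = a * n + b"
  have "a * n + b < Suc a * n" using ab by simp
  also have "\<dots> \<le> n * n" using ab by (intro mult_le_mono1) simp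
  finally have s: "s < n * n" "s div n = a" "s mod n = b" using ab by (auto simp: s_def)
  have "((Lyap ^^ k) X) $$ (a, b) = (\<Sum>r\<in>{0..<n * n}. (Kron ^\<^sub>m k) $$ (r, s) * flatten X $ r)" for k
  proof -
    have "((Lyap ^^ k) X) $$ (a, b) = flatten ((Lyap ^^ k) X) $ s"
      using s by (simp add: flatten_def)
    then show ?thesis
      using s carrier_matD[OF Kron_carrier] carrier_vecD[OF flatten_carrier, of X]
      by (auto simp: flatten_Lyap_funpow[OF X] scalar_prod_def intro!: sum.cong)
  qed
  moreover have "(\<lambda>k. \<Sum>r\<in>{0..<n * n}. (Kron ^\<^sub>m k) $$ (r, s) * flatten X $ r) \<longlonglongrightarrow> 0"
    using lim s by (intro tendsto_null_sum tendsto_mult_left_zero) auto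
  ultimately show ?thesis by simp
qed

text \<open>The full Neumann series of iterates of the identity would solve \<open>Q - Lyap Q = 1\<close>. A finite section
  is enough for a strict inequality and avoids infinite sums of matrices: the difference telescopes to
  \<open>1 - Lyap\<^sup>m 1\<close>.\<close>

lemma Lyapunov_solution_exists:
  assumes lim: "\<And>r s. r < n * n \<Longrightarrow> s < n * n \<Longrightarrow> (\<lambda>k. (Kron ^\<^sub>m k) $$ (r, s)) \<longlonglongrightarrow> 0"
  shows "\<exists>Q. pos_def_mat n Q \<and> neg_def_mat n (Lyap Q - Q)"
proof -
  define X where "X k = (Lyap ^^ k) (1\<^sub>m n)" for k
  have Xc: "X k \<in> carrier_mat n n" for k unfolding X_def by (intro Lyap_funpow_carrier) simp
  have XSuc: "X (Suc k) = Lyap (X k)" for k by (simp add: X_def)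
  have Xs: "transpose_mat (X k) = X k" for k
    by (induction k) (auto simp: XSuc Xc Lyap_symmetric, simp add: X_def)
  have Xnn: "0 \<le> bilin (X k) v v" if "v \<in> carrier_vec n" for k v
    using that
    by (induction k arbitrary: v) (auto simp: XSuc Xc intro: Lyap_nonneg, simp add: X_def bilin_one scalar_prod_self_nonneg)
  have "(\<lambda>k. \<Sum>a<n. \<Sum>b<n. \<bar>X k $$ (a, b)\<bar>) \<longlonglongrightarrow> 0"
    using Lyap_funpow_entries_tendsto_0[OF lim] unfolding X_def
    by (intro tendsto_null_sum tendsto_rabs_zero) auto
  then have "\<forall>\<^sub>F k in sequentially. (\<Sum>a<n. \<Sum>b<n. \<bar>X k $$ (a, b)\<bar>) < 1"
    by (rule order_tendstoD) simp
  \<comment> \<open>A nonempty section is needed for Q to be positive definite.\<close>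
  then obtain m where m: "0 < m" "(\<Sum>a<n. \<Sum>b<n. \<bar>X m $$ (a, b)\<bar>) < 1"
    using eventually_conj[OF eventually_gt_at_top[of 0]] eventually_happens'[OF sequentially_bot] by blast
  have Xm: "bilin (X m) v v < v \<bullet> v" if v: "v \<in> carrier_vec n" "v \<noteq> 0\<^sub>v n" for v
  proof -
    have "bilin (X m) v v \<le> (\<Sum>a<n. \<Sum>b<n. \<bar>X m $$ (a, b)\<bar>) * (v \<bullet> v)"
      using abs_bilin_le[OF Xc v(1) v(1), of m] by simp
    also have "\<dots> < 1 * (v \<bullet> v)"
      using m(2) scalar_prod_self_pos[OF v] by (intro mult_strict_right_mono)
    finally show ?thesis by simp
  qed
  define Q where "Q = mat_sum n X {..<m}"
  have Qc: "Q \<in> carrier_mat n n" by (simp add: Q_def)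
  have Qs: "transpose_mat Q = Q" unfolding Q_def using Xc Xs by (intro mat_sum_symmetric) auto
  have Qv: "bilin Q u v = (\<Sum>k<m. bilin (X k) u v)" if "u \<in> carrier_vec n" "v \<in> carrier_vec n" for u v
    unfolding Q_def using that Xc by (intro bilin_mat_sum)
  have LQv: "bilin (Lyap Q) v v = (\<Sum>k<m. bilin (X (Suc k)) v v)" if v: "v \<in> carrier_vec n" for v
  proof -
    have Av: "A i *\<^sub>v v \<in> carrier_vec n" if "i \<in> I" for i
      using A v that by (intro mult_mat_vec_carrier) auto
    have "bilin (Lyap Q) v v = (\<Sum>i\<in>I. \<Sum>k<m. w i * bilin (X k) (A i *\<^sub>v v) (A i *\<^sub>v v))"
      using v Qc Av by (simp add: bilin_Lyap Qv sum_distrib_left)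
    also have "\<dots> = (\<Sum>k<m. bilin (X (Suc k)) v v)"
      using v Xc by (subst sum.swap) (simp add: XSuc bilin_Lyap)
    finally show ?thesis .
  qed
  have X0: "bilin (X 0) v v = v \<bullet> v" if "v \<in> carrier_vec n" for v
    using that by (simp add: X_def bilin_one)
  have "pos_def_mat n Q"
    unfolding pos_def_mat_iff
  proof (intro conjI ballI impI)
    fix v :: "real vec" assume v: "v \<in> carrier_vec n" "v \<noteq> 0\<^sub>v n"
    show "0 < bilin Q v v"
      unfolding Qv[OF v(1) v(1)]
      using m(1) v Xnn scalar_prod_self_pos[OF v] by (intro sum_pos2[of _ 0]) (auto simp: X0)
  qed (use Qc Qs in auto)
  moreover have "neg_def_mat n (Lyap Q - Q)"
    unfolding neg_def_mat_diff_iff[OF Lyap_carrier Lyap_symmetric[OF Qc Qs] Qc Qs]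
  proof (intro ballI impI)
    fix v :: "real vec" assume v: "v \<in> carrier_vec n" "v \<noteq> 0\<^sub>v n"
    have "bilin (Lyap Q) v v - bilin Q v v = bilin (X m) v v - bilin (X 0) v v"
      unfolding LQv[OF v(1)] Qv[OF v(1) v(1)] sum_subtractf[symmetric] by (rule sum_lessThan_telescope)
    then show "bilin (Lyap Q) v v < bilin Q v v" using Xm[OF v] X0[OF v(1)] by simp
  qed
  ultimately show ?thesis by blast
qed

lemma Lyapunov_iff_spectral_radius:
  assumes "n > 0"
  shows "(\<exists>Q. pos_def_mat n Q \<and> neg_def_mat n (Lyap Q - Q)) \<longleftrightarrow>
    spectral_radius (map_mat complex_of_real Kron) < 1"
  using Kron_powers_tendsto_0 Lyapunov_solution_exists assms
    real_spectral_radius_less_1_iff_powers_tendsto_0[OF Kron_carrier] by (metis mult_pos_pos)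

section \<open>Splitting one inequality into coupled ones\<close>

lemma neg_def_block_iff:
  assumes "i \<in> I" "S \<in> carrier_mat n n" "transpose_mat S = S" "R \<in> carrier_mat n n" "transpose_mat R = R"
  shows "neg_def_mat n (c \<cdot>\<^sub>m (transpose_mat (A i) * S * A i) - R) \<longleftrightarrow>
    (\<forall>v\<in>carrier_vec n. v \<noteq> 0\<^sub>v n \<longrightarrow> c * bilin S (A i *\<^sub>v v) (A i *\<^sub>v v) < bilin R v v)"
proof -
  note B = congruence_carrier[OF assms(2) A[OF assms(1)]]
  have "transpose_mat (c \<cdot>\<^sub>m (transpose_mat (A i) * S * A i)) = c \<cdot>\<^sub>m (transpose_mat (A i) * S * A i)"
    by (rule weighted_congruence_symmetric[OF assms(2,3) A[OF assms(1)]])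
  moreover have "bilin (c \<cdot>\<^sub>m (transpose_mat (A i) * S * A i)) v v = c * bilin S (A i *\<^sub>v v) (A i *\<^sub>v v)"
    if "v \<in> carrier_vec n" for v
    using assms A that B by (simp add: bilin_smult[of _ n] bilin_congruence[of _ n])
  ultimately show ?thesis
    using assms B by (simp add: neg_def_mat_diff_iff)
qed

text \<open>Adding up the coupled inequalities produces \<open>Lyap S < S\<close> for the sum \<open>S\<close> of the unknowns. Strictness
  needs at least one summand.\<close>

lemma Lyapunov_from_blocks:
  assumes I: "finite I" "I \<noteq> {}" and R: "\<And>i. i \<in> I \<Longrightarrow> pos_def_mat n (R i)"
    and less: "\<And>i v. i \<in> I \<Longrightarrow> v \<in> carrier_vec n \<Longrightarrow> v \<noteq> 0\<^sub>v n \<Longrightarrow>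
      w i * bilin (mat_sum n R I) (A i *\<^sub>v v) (A i *\<^sub>v v) < bilin (R i) v v"
  shows "\<exists>Q. pos_def_mat n Q \<and> neg_def_mat n (Lyap Q - Q)"
proof (intro exI conjI)
  show S: "pos_def_mat n (mat_sum n R I)" by (rule pos_def_mat_sum[OF I R])
  have Ss: "transpose_mat (mat_sum n R I) = mat_sum n R I" using S by (simp add: pos_def_mat_def)
  show "neg_def_mat n (Lyap (mat_sum n R I) - mat_sum n R I)"
    unfolding neg_def_mat_diff_iff[OF Lyap_carrier Lyap_symmetric[OF mat_sum_carrier Ss] mat_sum_carrier Ss]
  proof (intro ballI impI)
    fix v :: "real vec" assume v: "v \<in> carrier_vec n" "v \<noteq> 0\<^sub>v n"
    have "bilin (Lyap (mat_sum n R I)) v v < (\<Sum>i\<in>I. bilin (R i) v v)"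
      using I less v by (auto simp: bilin_Lyap intro!: sum_strict_mono)
    also have "\<dots> = bilin (mat_sum n R I) v v"
      using R v by (subst bilin_mat_sum) (auto simp: pos_def_mat_def)
    finally show "bilin (Lyap (mat_sum n R I)) v v < bilin (mat_sum n R I) v v" .
  qed
qed

text \<open>The slack \<open>e\<close> of \<open>Lyap Q < Q\<close> is split into \<open>card I + 1\<close> equal parts, one for each unknown \<open>R i\<close>
  and one for \<open>P\<close>. The unknowns then add up to at most \<open>Q\<close>, while each \<open>R i\<close> exceeds the
  corresponding summand of \<open>Lyap Q\<close>.\<close>

lemma blocks_from_Lyapunov:
  assumes Q: "pos_def_mat n Q" and LQ: "neg_def_mat n (Lyap Q - Q)"
  obtains P R where "pos_def_mat n P" "\<forall>i\<in>I. pos_def_mat n (R i)"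
    "\<forall>i\<in>I. \<forall>v\<in>carrier_vec n. v \<noteq> 0\<^sub>v n \<longrightarrow>
      w i * bilin (P + mat_sum n R I) (A i *\<^sub>v v) (A i *\<^sub>v v) < bilin (R i) v v"
proof -
  have Qc: "Q \<in> carrier_mat n n" and Qs: "transpose_mat Q = Q"
    using Q by (auto simp: pos_def_mat_def)
  have "pos_def_mat n (Q - Lyap Q)" using LQ Qc by (simp add: neg_def_mat_diff)
  then obtain e where e: "e > 0"
    and gap: "\<And>v. v \<in> carrier_vec n \<Longrightarrow> e * (v \<bullet> v) \<le> bilin (Q - Lyap Q) v v"
    using pos_def_coercive by blast
  define d where "d = e / (real (card I) + 1)"
  have d: "d > 0" "d * (real (card I) + 1) = e" using e by (auto simp: d_def)
  define P where "P = d \<cdot>\<^sub>m 1\<^sub>m n"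
  define F where "F i = w i \<cdot>\<^sub>m (transpose_mat (A i) * Q * A i)" for i
  define R where "R i = F i + P" for i
  have Pc: "P \<in> carrier_mat n n" by (simp add: P_def)
  have Fc: "F i \<in> carrier_mat n n" if "i \<in> I" for i
    using congruence_carrier[OF Qc A[OF that]] by (simp add: F_def)
  have Rc: "R i \<in> carrier_mat n n" if "i \<in> I" for i using Pc Fc[OF that] by (simp add: R_def)
  have Pv: "bilin P v v = d * (v \<bullet> v)" if "v \<in> carrier_vec n" for v
    using that by (simp add: P_def bilin_smult[of _ n] bilin_one)
  have Fv: "bilin (F i) v v = w i * bilin Q (A i *\<^sub>v v) (A i *\<^sub>v v)" if "i \<in> I" "v \<in> carrier_vec n" for i v
    using that congruence_carrier[OF Qc A[OF that(1)]] Qc A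
    by (simp add: F_def bilin_smult[of _ n] bilin_congruence[of _ n])
  have Rv: "bilin (R i) v v = bilin (F i) v v + d * (v \<bullet> v)" if "i \<in> I" "v \<in> carrier_vec n" for i v
    using that Fc Pc by (simp add: R_def bilin_add[of _ n] Pv)
  have Av: "A i *\<^sub>v v \<in> carrier_vec n" if "i \<in> I" "v \<in> carrier_vec n" for i v
    using A that by (intro mult_mat_vec_carrier) auto
  show thesis
  proof
    have Ps: "transpose_mat P = P" by (simp add: P_def transpose_smult_mat transpose_one)
    then show "pos_def_mat n P"
      using Pc d scalar_prod_self_pos[of _ n] by (auto simp: pos_def_mat_iff Pv)
    show "\<forall>i\<in>I. pos_def_mat n (R i)"
      unfolding pos_def_mat_iff
    proof (intro conjI ballI impI)
      fix i assume i: "i \<in> I"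
      show "R i \<in> carrier_mat n n" by (rule Rc[OF i])
      have "transpose_mat (F i) = F i"
        unfolding F_def by (rule weighted_congruence_symmetric[OF Qc Qs A[OF i]])
      then show "transpose_mat (R i) = R i"
        using Ps Pc Fc[OF i] by (simp add: R_def transpose_add[of _ n n])
    next
      fix i and v :: "real vec" assume i: "i \<in> I" and v: "v \<in> carrier_vec n" "v \<noteq> 0\<^sub>v n"
      have "0 \<le> bilin (F i) v v"
        using w[OF i] pos_def_mat_nonneg[OF Q Av[OF i v(1)]] by (simp add: Fv[OF i v(1)])
      then show "0 < bilin (R i) v v"
        using d scalar_prod_self_pos[OF v] by (simp add: Rv[OF i v(1)] add_nonneg_pos)
    qed
    have total: "bilin (P + mat_sum n R I) v v \<le> bilin Q v v" if v: "v \<in> carrier_vec n" for v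
    proof -
      have "bilin (P + mat_sum n R I) v v = d * (v \<bullet> v) + (\<Sum>i\<in>I. bilin (R i) v v)"
        using v Pc Rc by (simp add: bilin_add[of _ n] Pv bilin_mat_sum[of I R n])
      also have "\<dots> = bilin (Lyap Q) v v + e * (v \<bullet> v)"
        using v Qc by (simp add: Rv Fv bilin_Lyap sum.distrib algebra_simps flip: d(2))
      also have "\<dots> \<le> bilin Q v v"
        using gap[OF v] v Qc by (simp add: bilin_diff[of _ n])
      finally show ?thesis .
    qed
    show "\<forall>i\<in>I. \<forall>v\<in>carrier_vec n. v \<noteq> 0\<^sub>v n \<longrightarrow>
      w i * bilin (P + mat_sum n R I) (A i *\<^sub>v v) (A i *\<^sub>v v) < bilin (R i) v v"
    proof (intro ballI impI)
      fix i and v :: "real vec" assume i: "i \<in> I" and v: "v \<in> carrier_vec n" "v \<noteq> 0\<^sub>v n"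
      have "w i * bilin (P + mat_sum n R I) (A i *\<^sub>v v) (A i *\<^sub>v v) \<le> bilin (F i) v v"
        unfolding Fv[OF i v(1)] by (rule mult_left_mono[OF total[OF Av[OF i v(1)]] w[OF i]])
      also have "\<dots> < bilin (R i) v v"
        using d scalar_prod_self_pos[OF v] by (simp add: Rv[OF i v(1)])
      finally show "w i * bilin (P + mat_sum n R I) (A i *\<^sub>v v) (A i *\<^sub>v v) < bilin (R i) v v" .
    qed
  qed
qed

end

theorem theorem3:
  fixes N n :: nat and A :: "nat \<Rightarrow> real mat" and \<tau> :: "nat \<Rightarrow> real"
  assumes "N \<ge> 1" and "n \<ge> 1"
    and "\<And>i. i \<in> {1..N} \<Longrightarrow> A i \<in> carrier_mat n n"
    and "\<And>i. i \<in> {1..N} \<Longrightarrow> \<tau> i > 0"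
  shows
    "((\<exists>P Q. pos_def_mat n P \<and> (\<forall>i\<in>{1..N}. pos_def_mat n (Q i)) \<and>
        (\<forall>i\<in>{1..N}. neg_def_mat n
          ((real N * \<tau> i) \<cdot>\<^sub>m (transpose_mat (A i) * (P + mat_sum n (\<lambda>j. \<tau> j \<cdot>\<^sub>m Q j) {1..N}) * A i)
            - Q i)))
      \<longleftrightarrow> spectral_radius (map_mat complex_of_real
            (mat_sum (n * n) (\<lambda>i. (\<tau> i)\<^sup>2 \<cdot>\<^sub>m (A i \<otimes>\<^sub>K A i)) {1..N})) < 1 / real N)
     \<and>
     ((\<exists>Q. (\<forall>i\<in>{1..N}. pos_def_mat n (Q i)) \<and>
        (\<forall>i\<in>{1..N}. neg_def_mat n
          ((real N * (\<tau> i)\<^sup>2) \<cdot>\<^sub>m (transpose_mat (A i) * mat_sum n Q {1..N} * A i) - Q i)))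
      \<longleftrightarrow> spectral_radius (map_mat complex_of_real
            (mat_sum (n * n) (\<lambda>i. (\<tau> i)\<^sup>2 \<cdot>\<^sub>m (A i \<otimes>\<^sub>K A i)) {1..N})) < 1 / real N)
     \<and>
     ((\<exists>Q. pos_def_mat n Q \<and>
        neg_def_mat n
          (mat_sum n (\<lambda>i. (real N * (\<tau> i)\<^sup>2) \<cdot>\<^sub>m (transpose_mat (A i) * Q * A i)) {1..N} - Q))
      \<longleftrightarrow> spectral_radius (map_mat complex_of_real
            (mat_sum (n * n) (\<lambda>i. (\<tau> i)\<^sup>2 \<cdot>\<^sub>m (A i \<otimes>\<^sub>K A i)) {1..N})) < 1 / real N)"
    (is "(?A \<longleftrightarrow> ?C) \<and> (?B \<longleftrightarrow> ?C) \<and> (?D \<longleftrightarrow> ?C)")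
proof -
  note N = assms(1) and n = assms(2) and A = assms(3) and \<tau> = assms(4)
  define w where "w = (\<lambda>i. real N * (\<tau> i)\<^sup>2)"
  interpret lyapunov_operator n "{1..N}" w A
    using A by unfold_locales (auto simp: w_def)
  let ?I = "{1..N}"
  have Av: "A i *\<^sub>v v \<in> carrier_vec n" if "i \<in> ?I" "v \<in> carrier_vec n" for i v
    using A that by (intro mult_mat_vec_carrier) auto
  have D_iff_Lyap: "?D \<longleftrightarrow> (\<exists>Q. pos_def_mat n Q \<and> neg_def_mat n (Lyap Q - Q))"
    unfolding Lyap_def unfolding w_def ..
  have D_iff_C: "?D \<longleftrightarrow> ?C"
  proof -
    let ?M = "mat_sum (n * n) (\<lambda>i. (\<tau> i)\<^sup>2 \<cdot>\<^sub>m (A i \<otimes>\<^sub>K A i)) ?I"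
    have "map_mat complex_of_real Kron = complex_of_real (real N) \<cdot>\<^sub>m map_mat complex_of_real ?M"
    proof (rule eq_matI)
      fix r s assume "r < dim_row (complex_of_real (real N) \<cdot>\<^sub>m map_mat complex_of_real ?M)"
        "s < dim_col (complex_of_real (real N) \<cdot>\<^sub>m map_mat complex_of_real ?M)"
      then have rs: "r < n * n" "s < n * n" by auto
      have "Kron $$ (r, s) = real N * ?M $$ (r, s)"
        using carrier_matD[OF kronecker_square(1)[OF A]] rs
        unfolding Kron_def mat_sum_index[OF rs]
        by (auto simp: w_def sum_distrib_left mult_ac intro!: sum.cong)
      then show "map_mat complex_of_real Kron $$ (r, s)
          = (complex_of_real (real N) \<cdot>\<^sub>m map_mat complex_of_real ?M) $$ (r, s)"
        using rs by (simp add: carrier_matD[OF Kron_carrier] del: mat_sum_index One_nat_def)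
    qed (auto simp: carrier_matD[OF Kron_carrier] simp del: One_nat_def)
    then have "spectral_radius (map_mat complex_of_real Kron)
        = real N * spectral_radius (map_mat complex_of_real ?M)"
      using spectral_radius_smult[of "map_mat complex_of_real ?M" "n * n" "real N"] N n by simp
    then show ?thesis
      unfolding D_iff_Lyap using Lyapunov_iff_spectral_radius N n by (simp add: field_simps)
  qed
  have A_imp_B: "?B" if hyp: ?A
  proof -
    obtain P Q where P: "pos_def_mat n P" and Q: "\<And>i. i \<in> ?I \<Longrightarrow> pos_def_mat n (Q i)"
      and less: "\<And>i. i \<in> ?I \<Longrightarrow> neg_def_mat n ((real N * \<tau> i) \<cdot>\<^sub>m
        (transpose_mat (A i) * (P + mat_sum n (\<lambda>j. \<tau> j \<cdot>\<^sub>m Q j) ?I) * A i) - Q i)"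
      using hyp by blast
    \<comment> \<open>Rescaling turns the weights of A into those of B; dropping P preserves the inequality.\<close>
    let ?R = "\<lambda>j. \<tau> j \<cdot>\<^sub>m Q j"
    let ?S = "mat_sum n ?R ?I"
    have R: "pos_def_mat n (?R i)" if "i \<in> ?I" for i
      using Q[OF that] \<tau>[OF that] by (auto simp: pos_def_mat_iff transpose_smult_mat bilin_smult[of _ n])
    have S: "pos_def_mat n ?S" using R N by (intro pos_def_mat_sum) auto
    have PS: "P + ?S \<in> carrier_mat n n" "transpose_mat (P + ?S) = P + ?S"
      using P S by (auto simp: pos_def_mat_def transpose_add[of _ n n])
    have B_ineq: "neg_def_mat n ((real N * (\<tau> i)\<^sup>2) \<cdot>\<^sub>m (transpose_mat (A i) * ?S * A i) - ?R i)"
      if i: "i \<in> ?I" for i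
    proof -
      have "real N * (\<tau> i)\<^sup>2 * bilin ?S (A i *\<^sub>v v) (A i *\<^sub>v v) < bilin (?R i) v v"
        if v: "v \<in> carrier_vec n" "v \<noteq> 0\<^sub>v n" for v
      proof -
        have "real N * \<tau> i * bilin ?S (A i *\<^sub>v v) (A i *\<^sub>v v)
            \<le> real N * \<tau> i * bilin (P + ?S) (A i *\<^sub>v v) (A i *\<^sub>v v)"
          using P pos_def_mat_nonneg[OF P Av[OF i v(1)]] Av[OF i v(1)] \<tau>[OF i]
          by (intro mult_left_mono) (auto simp: bilin_add[of _ n] pos_def_mat_def)
        also have "\<dots> < bilin (Q i) v v"
          using less[OF i] Q[OF i] v neg_def_block_iff[OF i PS] by (auto simp: pos_def_mat_def)
        finally have "\<tau> i * (real N * \<tau> i * bilin ?S (A i *\<^sub>v v) (A i *\<^sub>v v)) < \<tau> i * bilin (Q i) v v"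
          using \<tau>[OF i] by (intro mult_strict_left_mono)
        then show ?thesis
          using Q[OF i] v by (simp add: pos_def_mat_def bilin_smult[of _ n] power2_eq_square mult_ac)
      qed
      then show ?thesis
        using S R[OF i] by (subst neg_def_block_iff[OF i]) (auto simp: pos_def_mat_def)
    qed
    show ?B by (intro exI[of _ ?R] conjI ballI R B_ineq)
  qed
  have B_imp_D: "?D" if hyp: ?B
  proof -
    obtain R where R: "\<And>i. i \<in> ?I \<Longrightarrow> pos_def_mat n (R i)"
      and less: "\<And>i. i \<in> ?I \<Longrightarrow>
        neg_def_mat n (w i \<cdot>\<^sub>m (transpose_mat (A i) * mat_sum n R ?I * A i) - R i)"
      using hyp unfolding w_def by blast
    have S: "pos_def_mat n (mat_sum n R ?I)" using R N by (intro pos_def_mat_sum) auto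
    have "w i * bilin (mat_sum n R ?I) (A i *\<^sub>v v) (A i *\<^sub>v v) < bilin (R i) v v"
      if i: "i \<in> ?I" and v: "v \<in> carrier_vec n" "v \<noteq> 0\<^sub>v n" for i v
      using less[OF i] S R[OF i] v neg_def_block_iff[OF i, of "mat_sum n R ?I" "R i"]
      by (auto simp: pos_def_mat_def)
    then show ?D
      unfolding D_iff_Lyap using R N by (intro Lyapunov_from_blocks) auto
  qed
  have D_imp_A: "?A" if hyp: ?D
  proof -
    obtain Q0 where Q0: "pos_def_mat n Q0" "neg_def_mat n (Lyap Q0 - Q0)"
      using hyp unfolding D_iff_Lyap by blast
    obtain P R where P: "pos_def_mat n P" and R_all: "\<forall>i\<in>?I. pos_def_mat n (R i)"
      and less_all: "\<forall>i\<in>?I. \<forall>v\<in>carrier_vec n. v \<noteq> 0\<^sub>v n \<longrightarrow>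
        w i * bilin (P + mat_sum n R ?I) (A i *\<^sub>v v) (A i *\<^sub>v v) < bilin (R i) v v"
      by (rule blocks_from_Lyapunov[OF Q0])
    note R = bspec[OF R_all] and less = less_all[rule_format]
    \<comment> \<open>The inverse of the rescaling that leads from A to B.\<close>
    define Q where "Q i = (1 / \<tau> i) \<cdot>\<^sub>m R i" for i
    have Q: "pos_def_mat n (Q i)" if "i \<in> ?I" for i
      using R[OF that] \<tau>[OF that]
      by (auto simp: Q_def pos_def_mat_iff transpose_smult_mat bilin_smult[of _ n])
    have S: "mat_sum n (\<lambda>j. \<tau> j \<cdot>\<^sub>m Q j) ?I = mat_sum n R ?I"
    proof (rule eq_matI)
      fix a b assume "a < dim_row (mat_sum n R ?I)" "b < dim_col (mat_sum n R ?I)"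
      then have ab: "a < n" "b < n" by auto
      have "(\<tau> j \<cdot>\<^sub>m Q j) $$ (a, b) = R j $$ (a, b)" if "j \<in> ?I" for j
        using ab \<tau>[OF that] R[OF that] by (auto simp: Q_def pos_def_mat_def)
      then show "mat_sum n (\<lambda>j. \<tau> j \<cdot>\<^sub>m Q j) ?I $$ (a, b) = mat_sum n R ?I $$ (a, b)"
        using ab by simp
    qed auto
    have "pos_def_mat n (mat_sum n R ?I)" using R N by (intro pos_def_mat_sum) auto
    then have PS: "P + mat_sum n R ?I \<in> carrier_mat n n"
      "transpose_mat (P + mat_sum n R ?I) = P + mat_sum n R ?I"
      using P by (auto simp: pos_def_mat_def transpose_add[of _ n n])
    have A_ineq: "neg_def_mat n ((real N * \<tau> i) \<cdot>\<^sub>m (transpose_mat (A i) * (P + mat_sum n R ?I) * A i) - Q i)"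
      if i: "i \<in> ?I" for i
    proof -
      have "real N * \<tau> i * bilin (P + mat_sum n R ?I) (A i *\<^sub>v v) (A i *\<^sub>v v) < bilin (Q i) v v"
        if v: "v \<in> carrier_vec n" "v \<noteq> 0\<^sub>v n" for v
        using less[OF i v] \<tau>[OF i] R[OF i] v
        by (simp add: Q_def w_def pos_def_mat_def bilin_smult[of _ n] power2_eq_square field_simps)
      then show ?thesis
        using Q[OF i] by (subst neg_def_block_iff[OF i PS]) (auto simp: pos_def_mat_def)
    qed
    show ?A by (intro exI[of _ P] exI[of _ Q] conjI ballI P Q A_ineq[folded S])
  qed
  show ?thesis using D_iff_C A_imp_B B_imp_D D_imp_A by blast
qed

end
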